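(* Let $\Sigma=\{\sigma_1,\ldots,\sigma_n\}$ be a semigroup of maps on $\{1,\ldots,N\}$, let $V$ be a finite dimensional real vector space and let $f:V^n\to V$ be smooth. All maps $\pi_i:V^N\to V^n$ conjugate $\gamma_f$ to $\Gamma_f$, that is, $$\Gamma_f\circ\pi_i=\pi_i\circ\gamma_f\quad\text{for all }1\le i\le N.$$
   Context: $N,n\ge 1$ are integers and $\Sigma=\{\sigma_1,\ldots,\sigma_n\}$ is a collection of $n$ distinct maps $\sigma_j:\{1,\ldots,N\}\to\{1,\ldots,N\}$. $\Sigma$ is called a semigroup if for all $1\le j_1,j_2\le n$ there is a unique $1\le j_3\le n$ with $\sigma_{j_1}\circ\sigma_{j_2}=\sigma_{j_3}$. In that case $\widetilde\sigma_j:\{1,\ldots,n\}\to\{1,\ldots,n\}$ is determined by $\sigma_{\widetilde\sigma_j(k)}=\sigma_j\circ\sigma_k$, and $A_{\sigma_j}(X_1,\ldots,X_n)=(X_{\widetilde\sigma_1(j)},\ldots,X_{\widetilde\sigma_n(j)})$ on $V^n$. The map $\pi_i:V^N\to V^n$ is $\pi_i(x_1,\ldots,x_N)=(x_{\sigma_1(i)},\ldots,x_{\sigma_n(i)})$. The network map $\gamma_f:V^N\to V^N$ is $(\gamma_f)_i=f\circ\pi_i$ for $1\le i\le N$. The fundamental network $\Gamma_f:V^n\to V^n$ is $(\Gamma_f)_j(X)=f(X_{\widetilde\sigma_1(j)},\ldots,X_{\widetilde\sigma_n(j)})=f(A_{\sigma_j}X)$ for $1\le j\le n$. *)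

theory Defs
  imports "HOL-Analysis.Analysis"
begin

text \<open>
  The index sets \<open>{1..N}\<close> and \<open>{1..n}\<close> are finite types \<open>'N\<close> and \<open>'n\<close> (arbitrary, nonempty), so that
  \<open>V\<^sup>N\<close> and \<open>V\<^sup>n\<close> are \<open>'v ^ 'N\<close> and \<open>'v ^ 'n\<close>. A family \<open>\<sigma>\<close> lists the maps
  \<open>\<sigma>\<^sub>1, \<dots>, \<sigma>\<^sub>n\<close>; injectivity of \<open>\<sigma>\<close> says that they are distinct.
\<close>

definition semigroup_of_maps :: "('n::finite \<Rightarrow> 'N::finite \<Rightarrow> 'N) \<Rightarrow> bool" where
  "semigroup_of_maps \<sigma> \<longleftrightarrow> inj \<sigma> \<and> (\<forall>j1 j2. \<exists>!j3. \<sigma> j1 \<circ> \<sigma> j2 = \<sigma> j3)"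

definition sigma_tilde :: "('n::finite \<Rightarrow> 'N::finite \<Rightarrow> 'N) \<Rightarrow> 'n \<Rightarrow> 'n \<Rightarrow> 'n" where
  "sigma_tilde \<sigma> j k = (THE l. \<sigma> l = \<sigma> j \<circ> \<sigma> k)"

text \<open>
  The \<open>k\<close>-th component of \<open>A\<^bsub>\<sigma>\<^sub>j\<^esub> X\<close> has index \<open>sigma_tilde \<sigma> k j\<close>, not \<open>sigma_tilde \<sigma> j k\<close>.
\<close>

definition A_map :: "('n::finite \<Rightarrow> 'N::finite \<Rightarrow> 'N) \<Rightarrow> 'n \<Rightarrow> 'v ^ 'n \<Rightarrow> 'v ^ 'n" where
  "A_map \<sigma> j X = (\<chi> k. X $ sigma_tilde \<sigma> k j)"

definition pi_map :: "('n::finite \<Rightarrow> 'N::finite \<Rightarrow> 'N) \<Rightarrow> 'N \<Rightarrow> 'v ^ 'N \<Rightarrow> 'v ^ 'n" where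
  "pi_map \<sigma> i x = (\<chi> j. x $ \<sigma> j i)"

definition network_map ::
    "('n::finite \<Rightarrow> 'N::finite \<Rightarrow> 'N) \<Rightarrow> ('v ^ 'n \<Rightarrow> 'v) \<Rightarrow> 'v ^ 'N \<Rightarrow> 'v ^ 'N" where
  "network_map \<sigma> f x = (\<chi> i. (f \<circ> pi_map \<sigma> i) x)"

definition fundamental_network ::
    "('n::finite \<Rightarrow> 'N::finite \<Rightarrow> 'N) \<Rightarrow> ('v ^ 'n \<Rightarrow> 'v) \<Rightarrow> 'v ^ 'n \<Rightarrow> 'v ^ 'n" where
  "fundamental_network \<sigma> f X = (\<chi> j. f (A_map \<sigma> j X))"

text \<open>
  A finite dimensional real vector space is modelled as a real normed space spanned by a finite
  set. The norm only serves to make differentiability meaningful: on a finite dimensional space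
  norms exist and are all equivalent. The class \<open>euclidean_space\<close> would exclude
  the zero space.
\<close>

definition finite_dimensional :: "'v::real_vector itself \<Rightarrow> bool" where
  "finite_dimensional _ \<longleftrightarrow> (\<exists>B :: 'v set. finite B \<and> span B = UNIV)"

text \<open>
  \<open>C\<^sup>k\<close> maps, by recursion on the directional derivatives \<open>x \<mapsto> Df(x) v\<close>. On a finite dimensional
  domain, continuity of all of these is continuity of \<open>Df\<close> in the operator norm, so this is the
  usual notion there.
\<close>

primrec Ck_map :: "nat \<Rightarrow> ('a::real_normed_vector \<Rightarrow> 'b::real_normed_vector) \<Rightarrow> bool" where
  "Ck_map 0 f \<longleftrightarrow> continuous_on UNIV f"
| "Ck_map (Suc k) f \<longleftrightarrow>
     (\<forall>x. f differentiable (at x)) \<and> (\<forall>v. Ck_map k (\<lambda>x. frechet_derivative f (at x) v))"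

definition smooth_map :: "('a::real_normed_vector \<Rightarrow> 'b::real_normed_vector) \<Rightarrow> bool" where
  "smooth_map f \<longleftrightarrow> (\<forall>k. Ck_map k f)"

end

theory Submission
  imports Defs
begin

text \<open>
  Component \<open>j\<close> of \<open>pi_map \<sigma> i (network_map \<sigma> f x)\<close> is the response of cell \<open>\<sigma> j i\<close>, that is,
  \<open>f\<close> evaluated at the input \<open>pi_map \<sigma> (\<sigma> j i) x\<close>. So everything rests on the linear identity
  \<open>A_map \<sigma> j \<circ> pi_map \<sigma> i = pi_map \<sigma> (\<sigma> j i)\<close>, which says that what cell \<open>\<sigma> j i\<close> sees can be
  read off from what cell \<open>i\<close> sees: the cell \<open>\<sigma> k (\<sigma> j i)\<close> is \<open>\<sigma> l i\<close> for the index \<open>l\<close> of the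
  product \<open>\<sigma> k \<circ> \<sigma> j\<close>. This is exactly where closure of \<open>\<sigma>\<close> under composition enters.
\<close>

lemma sigma_tilde_represents_composition:
  assumes "semigroup_of_maps \<sigma>"
  shows "\<sigma> (sigma_tilde \<sigma> j k) = \<sigma> j \<circ> \<sigma> k"
proof -
  have "\<exists>!l. \<sigma> l = \<sigma> j \<circ> \<sigma> k"
    using assms unfolding semigroup_of_maps_def by metis
  then show ?thesis
    unfolding sigma_tilde_def by (rule theI')
qed

text \<open>
  The order of the factors matters: \<open>A_map \<sigma> j\<close> multiplies by \<open>\<sigma> j\<close> on the right, so that
  \<open>\<sigma> j\<close> acts on the cell \<open>i\<close> first and can be absorbed into the base point of the projection.
\<close>

lemma A_map_pi_map:
  assumes "semigroup_of_maps \<sigma>"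
  shows "A_map \<sigma> j (pi_map \<sigma> i x) = pi_map \<sigma> (\<sigma> j i) x"
  by (simp add: A_map_def pi_map_def sigma_tilde_represents_composition[OF assms])

theorem theorem10p1:
  fixes \<sigma> :: "'n::finite \<Rightarrow> 'N::finite \<Rightarrow> 'N"
    and f :: "('v::real_normed_vector) ^ 'n \<Rightarrow> 'v"
  assumes "semigroup_of_maps \<sigma>"
    and "finite_dimensional TYPE('v)"
    and "smooth_map f"
  shows "\<forall>i::'N. fundamental_network \<sigma> f \<circ> pi_map \<sigma> i = pi_map \<sigma> i \<circ> network_map \<sigma> f"
proof (intro allI ext)
  fix i :: 'N and x :: "'v ^ 'N"
  have "fundamental_network \<sigma> f (pi_map \<sigma> i x) = (\<chi> j. f (pi_map \<sigma> (\<sigma> j i) x))"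
    by (simp add: fundamental_network_def A_map_pi_map[OF assms(1)])
  also have "\<dots> = pi_map \<sigma> i (network_map \<sigma> f x)"
    by (simp add: pi_map_def[of \<sigma> i] network_map_def)
  finally show "(fundamental_network \<sigma> f \<circ> pi_map \<sigma> i) x = (pi_map \<sigma> i \<circ> network_map \<sigma> f) x"
    by simp
qed

end
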